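(* For all positive integers $m$ and $k$, the alternating multiple zeta values $$\zeta\left(\bar1,\{1\}_{m-1},\bar1\right)\quad\text{and}\quad\zeta\left(\bar1,\{1\}_{m-1},2,\{1\}_{k-1}\right)$$ are expressible in terms of zeta values, polylogarithms (at $\tfrac12$) and $\ln2$; that is, each of them is a rational linear combination of products of numbers from the set $\{\ln2\}\cup\{\zeta(n):n\ge2\}\cup\{\mathrm{Li}_n(\tfrac12):n\ge1\}$.
   Context: Notation. $\{1\}_r$ denotes the string of $r$ entries equal to $1$ (empty if $r=0$). For positive integers $s_1,\dots,s_r$, $\zeta(s_1,\dots,s_r):=\lim_{n\to\infty}\sum_{n\ge k_1>\cdots>k_r\ge1}\frac{1}{k_1^{s_1}\cdots k_r^{s_r}}$, and a bar over an entry $s_j$ means that the factor $(-1)^{k_j}$ is inserted in the summand; e.g. $\zeta(\bar1,\{1\}_{m-1},\bar1)=\lim_{n\to\infty}\sum_{n\ge k_1>\cdots>k_{m+1}\ge1}\frac{(-1)^{k_1+k_{m+1}}}{k_1\cdots k_{m+1}}$. $\zeta(n)$ is the Riemann zeta value and $\mathrm{Li}_p(x):=\sum_{n\ge1}x^n/n^p$. *)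

theory Defs
  imports Complex_Main
begin

datatype mzv_entry = Plain nat | Bar nat

fun mzv_factor :: "mzv_entry \<Rightarrow> nat \<Rightarrow> real" where
  "mzv_factor (Plain s) k = 1 / real k ^ s"
| "mzv_factor (Bar s) k = (- 1) ^ k / real k ^ s"

text \<open>The lists \<open>ks\<close> are the index tuples \<open>n \<ge> k\<^sub>1 > \<dots> > k\<^sub>r \<ge> 1\<close>.\<close>

definition alt_mzv_trunc :: "mzv_entry list \<Rightarrow> nat \<Rightarrow> real" where
  "alt_mzv_trunc s n =
     (\<Sum>ks | length ks = length s \<and> sorted_wrt (>) ks \<and> set ks \<subseteq> {1..n}.
        \<Prod>j<length s. mzv_factor (s ! j) (ks ! j))"

text \<open>The limit is in general only conditional, so it is taken along the
  truncation \<open>k\<^sub>1 \<le> n\<close> and not as an unordered sum.\<close>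

definition alt_mzv :: "mzv_entry list \<Rightarrow> real" where
  "alt_mzv s = lim (alt_mzv_trunc s)"

text \<open>Both series are indexed from 0, hence the shift by \<open>Suc\<close>. Used for \<open>p \<ge> 2\<close>
  and for \<open>\<bar>x\<bar> < 1\<close>, respectively, where they converge.\<close>

definition zeta_value :: "nat \<Rightarrow> real" where
  "zeta_value p = (\<Sum>n. 1 / real (Suc n) ^ p)"

definition polylog :: "nat \<Rightarrow> real \<Rightarrow> real" where
  "polylog p x = (\<Sum>n. x ^ Suc n / real (Suc n) ^ p)"

definition basic_constants :: "real set" where
  "basic_constants = {ln 2} \<union> {zeta_value n | n. n \<ge> 2} \<union> {polylog n (1/2) | n. n \<ge> 1}"

text \<open>Only nonempty products: the constant 1 is not admitted for free.\<close>

definition products_of :: "real set \<Rightarrow> real set" where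
  "products_of G = {prod_list xs | xs. xs \<noteq> [] \<and> set xs \<subseteq> G}"

interpretation real_over_rat: vector_space "\<lambda>(q::rat) (x::real). of_rat q * x"
  by unfold_locales (simp_all add: algebra_simps of_rat_add of_rat_mult)

end

theory Submission
  imports Defs "HOL-Analysis.Uniform_Limit" "HOL-Real_Asymp.Real_Asymp"
begin

text \<open>
  Put the outermost summation index into a power series, whose value at \<open>-t\<close> tends to the
  alternating multiple zeta value as \<open>t\<close> tends to \<open>1\<close> from the left (Abel). On \<open>(-1, 1)\<close> these
  series satisfy first-order differential equations: prepending an entry \<open>1\<close> inverts
  \<open>(1 - x) d/dx\<close>, raising the first entry inverts \<open>x d/dx\<close>. Writing \<open>\<Lambda> = ln (1 + t)\<close>, the solutions
  for the two families at \<open>x = -t\<close> are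
  \<open>(-1)\<^sup>m (Li\<^bsub>m+1\<^esub>((1 + t)/2) - \<Sum>\<^bsub>j\<le>m\<^esub> \<Lambda>\<^sup>j/j! Li\<^bsub>m+1-j\<^esub>(1/2))\<close> and a rational combination of
  \<open>\<Lambda>\<^bsup>m-i\<^esup> P\<^bsub>k+i\<^esub>(t)\<close>, \<open>i \<le> m\<close>, where \<open>P\<^sub>q(t)\<close> is the integral of \<open>ln\<^sup>q(1 + s)/s\<close> over \<open>[0, t]\<close>. The
  substitution \<open>u = 1/(1 + s)\<close> turns \<open>P\<^sub>q(t)\<close> into polylogarithms of \<open>1/(1 + t)\<close>, which is \<open>1/2\<close> in
  the limit.
\<close>

section \<open>Truncated sums and generating functions\<close>

definition mzv_tuples :: "nat \<Rightarrow> nat \<Rightarrow> nat list set" where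
  "mzv_tuples r n = {ks. length ks = r \<and> sorted_wrt (>) ks \<and> set ks \<subseteq> {1..n}}"

lemma finite_mzv_tuples: "finite (mzv_tuples r n)"
proof (rule finite_subset)
  show "mzv_tuples r n \<subseteq> {ks. set ks \<subseteq> {1..n} \<and> length ks = r}"
    by (auto simp: mzv_tuples_def)
qed (rule finite_lists_length_eq, simp)

lemma alt_mzv_trunc_Nil: "alt_mzv_trunc [] n = 1"
proof -
  have "{ks. length ks = length ([] :: mzv_entry list) \<and> sorted_wrt (>) ks \<and> set ks \<subseteq> {1..n}} = {[]}"
    by auto
  then show ?thesis by (simp add: alt_mzv_trunc_def)
qed

text \<open>The head of a strictly decreasing tuple is its largest index k, and the tail is an
  arbitrary decreasing tuple bounded by k - 1.\<close>

lemma bij_betw_mzv_tuples_Cons: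
  "bij_betw (\<lambda>(k, ks). k # ks) (SIGMA k:{1..n}. mzv_tuples r (k - 1)) (mzv_tuples (Suc r) n)"
proof (rule bij_betw_imageI)
  show "inj_on (\<lambda>(k, ks). k # ks) (SIGMA k:{1..n}. mzv_tuples r (k - 1))"
    by (auto simp: inj_on_def)
  show "(\<lambda>(k, ks). k # ks) ` (SIGMA k:{1..n}. mzv_tuples r (k - 1)) = mzv_tuples (Suc r) n"
  proof (intro equalityI subsetI)
    fix xs assume "xs \<in> (\<lambda>(k, ks). k # ks) ` (SIGMA k:{1..n}. mzv_tuples r (k - 1))"
    then show "xs \<in> mzv_tuples (Suc r) n"
      by (force simp: mzv_tuples_def)
  next
    fix xs assume xs: "xs \<in> mzv_tuples (Suc r) n"
    then obtain k ks where eq: "xs = k # ks" by (auto simp: mzv_tuples_def length_Suc_conv)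
    with xs have "k \<in> {1..n}" "ks \<in> mzv_tuples r (k - 1)"
      by (fastforce simp: mzv_tuples_def)+
    then show "xs \<in> (\<lambda>(k, ks). k # ks) ` (SIGMA k:{1..n}. mzv_tuples r (k - 1))"
      using eq by force
  qed
qed

text \<open>Regroups the tuples by the outermost index. Together with
  \<open>alt_mzv_trunc_Nil\<close> this recursion replaces the tuples in everything that
  follows.\<close>

lemma alt_mzv_trunc_Cons:
  "alt_mzv_trunc (e # s) n = (\<Sum>k=1..n. mzv_factor e k * alt_mzv_trunc s (k - 1))"
proof -
  define h where "h = (\<lambda>ks. \<Prod>j<length s. mzv_factor (s ! j) (ks ! j))"
  have "alt_mzv_trunc (e # s) n =
      (\<Sum>ks\<in>mzv_tuples (Suc (length s)) n. \<Prod>j<Suc (length s). mzv_factor ((e # s) ! j) (ks ! j))"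
    by (simp add: alt_mzv_trunc_def mzv_tuples_def)
  also have "\<dots> = (\<Sum>(k, ks)\<in>(SIGMA k:{1..n}. mzv_tuples (length s) (k - 1)).
      \<Prod>j<Suc (length s). mzv_factor ((e # s) ! j) ((k # ks) ! j))"
    by (subst sum.reindex_bij_betw[OF bij_betw_mzv_tuples_Cons, symmetric])
       (simp add: case_prod_unfold)
  also have "\<dots> = (\<Sum>(k, ks)\<in>(SIGMA k:{1..n}. mzv_tuples (length s) (k - 1)). mzv_factor e k * h ks)"
    by (simp add: prod.lessThan_Suc_shift h_def del: prod.lessThan_Suc)
  also have "\<dots> = (\<Sum>k=1..n. \<Sum>ks\<in>mzv_tuples (length s) (k - 1). mzv_factor e k * h ks)"
    by (subst sum.Sigma) (auto simp: finite_mzv_tuples)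
  also have "\<dots> = (\<Sum>k=1..n. mzv_factor e k * alt_mzv_trunc s (k - 1))"
    by (simp add: alt_mzv_trunc_def mzv_tuples_def h_def sum_distrib_left)
  finally show ?thesis .
qed

fun mzv_weight :: "mzv_entry \<Rightarrow> nat" where
  "mzv_weight (Plain s) = s"
| "mzv_weight (Bar s) = s"

text \<open>A positive exponent makes each factor vanish at index 0 (where exponent 0 would give 1 /
  0^0 = 1) and bounds it by 1/n.\<close>

definition pos_weights :: "mzv_entry list \<Rightarrow> bool" where
  "pos_weights s \<longleftrightarrow> (\<forall>e\<in>set s. mzv_weight e \<ge> 1)"

lemma pos_weights_simps [simp]:
  "pos_weights []"
  "pos_weights (e # s) \<longleftrightarrow> mzv_weight e \<ge> 1 \<and> pos_weights s"
  "pos_weights (s @ s') \<longleftrightarrow> pos_weights s \<and> pos_weights s'"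
  "pos_weights (replicate n e) \<longleftrightarrow> n = 0 \<or> mzv_weight e \<ge> 1"
  by (auto simp: pos_weights_def)

text \<open>The value on the empty list makes \<open>alt_mzv_trunc\<close> the partial sums of \<open>mzv_coeff\<close> and
  the differential equation for a prepended \<open>1\<close> valid without a special case.\<close>

fun mzv_coeff :: "mzv_entry list \<Rightarrow> nat \<Rightarrow> real" where
  "mzv_coeff [] n = (if n = 0 then 1 else 0)"
| "mzv_coeff (e # s) n = mzv_factor e n * alt_mzv_trunc s (n - 1)"

lemma mzv_factor_0: "mzv_weight e \<ge> 1 \<Longrightarrow> mzv_factor e 0 = 0"
  by (cases e) (auto simp: power_0_left)

lemma abs_mzv_factor_le:
  assumes "mzv_weight e \<ge> 1"
  shows "\<bar>mzv_factor e n\<bar> \<le> 1 / real n"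
proof (cases "n = 0")
  case False
  then have "real n ^ 1 \<le> real n ^ mzv_weight e"
    using assms by (intro power_increasing) auto
  with False show ?thesis
    by (cases e) (auto simp: abs_mult power_abs intro!: divide_left_mono)
qed (use assms in \<open>simp add: mzv_factor_0\<close>)

text \<open>The extra index 0 contributes nothing for a nonempty list, and the whole value 1 for the
  empty one.\<close>

lemma alt_mzv_trunc_eq_sum_coeff:
  "pos_weights s \<Longrightarrow> alt_mzv_trunc s n = (\<Sum>k\<le>n. mzv_coeff s k)"
proof (cases s)
  case (Cons e s')
  assume "pos_weights s"
  then show ?thesis using Cons
    by (simp add: alt_mzv_trunc_Cons atMost_atLeast0 sum.atLeast_Suc_atMost mzv_factor_0)
qed (simp add: alt_mzv_trunc_Nil)

section \<open>Growth of truncated sums and coefficients\<close>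

lemma sum_inverse_sqrt_le: "(\<Sum>k=1..n. 1 / sqrt (real k)) \<le> 2 * sqrt (real n)"
proof (induction n)
  case (Suc n)
  define a b where "a = sqrt (real n)" and "b = sqrt (real (Suc n))"
  have ab: "0 \<le> a" "a \<le> b" "0 < b" "b * b = a * a + 1"
    by (simp_all add: a_def b_def)
  \<comment> \<open>Expanded with b^2 = a^2 + 1, this square yields 1/b \<le> 2 (b - a), the
    increment of the bound.\<close>
  have "0 \<le> (b - a) * (b - a)" by simp
  with ab have "2 * a * b + 1 \<le> 2 * b * b" by (simp add: algebra_simps)
  then have "2 * a + 1 / b \<le> 2 * b" using ab by (simp add: field_simps)
  with Suc show ?case by (simp add: a_def b_def)
qed simp

text \<open>A square root is a crude bound, but it reproduces itself under the recursion: a factor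
  at most 1/k times sqrt k sums to at most 2 sqrt n, so each entry costs a factor 2. Using
  \<open>Suc n\<close> covers n = 0 and turns into k when the inner sum is truncated at k -
  1.\<close>

lemma abs_alt_mzv_trunc_le:
  "pos_weights s \<Longrightarrow> \<bar>alt_mzv_trunc s n\<bar> \<le> 2 ^ length s * sqrt (real (Suc n))"
proof (induction s arbitrary: n)
  case (Cons e s)
  have "\<bar>alt_mzv_trunc (e # s) n\<bar> \<le> (\<Sum>k=1..n. \<bar>mzv_factor e k\<bar> * \<bar>alt_mzv_trunc s (k - 1)\<bar>)"
    unfolding alt_mzv_trunc_Cons using sum_abs by (simp flip: abs_mult)
  also have "\<dots> \<le> (\<Sum>k=1..n. 2 ^ length s * (1 / sqrt (real k)))"
  proof (rule sum_mono)
    fix k assume k: "k \<in> {1..n}"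
    have "\<bar>mzv_factor e k\<bar> * \<bar>alt_mzv_trunc s (k - 1)\<bar>
        \<le> (1 / real k) * (2 ^ length s * sqrt (real (Suc (k - 1))))"
      using Cons by (intro mult_mono abs_mzv_factor_le Cons.IH) auto
    also have "\<dots> = 2 ^ length s * (sqrt (real k) / real k)" using k by simp
    also have "sqrt (real k) / real k = 1 / sqrt (real k)"
      by (metis inverse_eq_divide of_nat_0_le_iff sqrt_divide_self_eq)
    finally show "\<bar>mzv_factor e k\<bar> * \<bar>alt_mzv_trunc s (k - 1)\<bar> \<le> 2 ^ length s * (1 / sqrt (real k))" .
  qed
  also have "\<dots> \<le> 2 ^ length s * (2 * sqrt (real n))"
    unfolding sum_distrib_left[symmetric]
    by (intro mult_left_mono sum_inverse_sqrt_le) auto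
  also have "\<dots> \<le> 2 ^ length (e # s) * sqrt (real (Suc n))" by simp
  finally show ?case .
qed (simp add: alt_mzv_trunc_Nil)

lemma abs_mzv_coeff_le:
  assumes "pos_weights s" "n \<ge> 1"
  shows "\<bar>mzv_coeff s n\<bar> \<le> 2 ^ length s / sqrt (real n)"
proof (cases s)
  case (Cons e s')
  have "\<bar>mzv_coeff s n\<bar> \<le> (1 / real n) * (2 ^ length s' * sqrt (real (Suc (n - 1))))"
    using Cons assms unfolding Cons mzv_coeff.simps abs_mult
    by (intro mult_mono abs_mzv_factor_le abs_alt_mzv_trunc_le) auto
  also have "\<dots> = 2 ^ length s' * (sqrt (real n) / real n)" using assms by simp
  also have "sqrt (real n) / real n = 1 / sqrt (real n)"
    by (metis inverse_eq_divide of_nat_0_le_iff sqrt_divide_self_eq)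
  also have "2 ^ length s' * (1 / sqrt (real n)) \<le> 2 ^ length s / sqrt (real n)"
    using Cons by (auto intro!: divide_right_mono)
  finally show ?thesis .
qed (use assms in simp)

lemma abs_mzv_coeff_le_const:
  assumes "pos_weights s"
  shows "\<bar>mzv_coeff s n\<bar> \<le> 2 ^ length s"
proof (cases "n = 0")
  case True
  then show ?thesis using assms by (cases s) (auto simp: mzv_factor_0)
next
  case False
  then have "\<bar>mzv_coeff s n\<bar> \<le> 2 ^ length s / sqrt (real n)"
    using abs_mzv_coeff_le assms by simp
  also have "\<dots> \<le> 2 ^ length s / 1" using False by (intro divide_left_mono) auto
  finally show ?thesis by simp
qed

section \<open>Power series in the outermost index and their differential equations\<close>

definition mzv_series :: "mzv_entry list \<Rightarrow> real \<Rightarrow> real" where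
  "mzv_series s x = (\<Sum>n. mzv_coeff s n * x ^ n)"

lemma summable_mzv_series:
  assumes "pos_weights s" "\<bar>x\<bar> < 1"
  shows "summable (\<lambda>n. mzv_coeff s n * x ^ n)"
proof (rule summable_comparison_test)
  show "\<exists>N. \<forall>n\<ge>N. norm (mzv_coeff s n * x ^ n) \<le> 2 ^ length s * \<bar>x\<bar> ^ n"
    using abs_mzv_coeff_le_const[OF assms(1)]
    by (auto simp: abs_mult power_abs intro!: mult_right_mono)
  show "summable (\<lambda>n. 2 ^ length s * \<bar>x\<bar> ^ n)"
    using assms by (intro summable_mult summable_geometric) auto
qed

lemma mzv_series_Nil: "mzv_series [] x = 1"
proof -
  have "(\<lambda>n. mzv_coeff [] n * x ^ n) = (\<lambda>n. if n = 0 then 1 else 0)" by auto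
  then show ?thesis unfolding mzv_series_def using sums_single[of 0 "\<lambda>_. 1::real"]
    by (simp add: sums_iff)
qed

lemma mzv_series_0: "pos_weights s \<Longrightarrow> s \<noteq> [] \<Longrightarrow> mzv_series s 0 = 0"
  unfolding mzv_series_def powser_zero by (cases s) (auto simp: mzv_factor_0)

text \<open>The sign of a barred first entry depends on the same index as the power of x, so it can
  be absorbed into the argument.\<close>

lemma mzv_series_Bar: "mzv_series (Bar p # s) x = mzv_series (Plain p # s) (- x)"
  unfolding mzv_series_def by (simp add: power_minus[of x] mult_ac)

lemma DERIV_mzv_series:
  assumes "pos_weights s" "\<bar>x\<bar> < 1"
  shows "(mzv_series s has_field_derivative (\<Sum>n. diffs (mzv_coeff s) n * x ^ n)) (at x)"
  unfolding mzv_series_def[abs_def]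
  by (rule termdiffs_strong'[where K = 1]) (use assms summable_mzv_series in auto)

lemma summable_diffs_mzv_coeff:
  assumes "pos_weights s" "\<bar>x\<bar> < 1"
  shows "summable (\<lambda>n. diffs (mzv_coeff s) n * x ^ n)"
  by (rule termdiff_converges[where K = 1]) (use assms summable_mzv_series in auto)

text \<open>Termwise differentiation multiplies the n-th coefficient by n, which lowers the first
  exponent by one; the division by x undoes the index shift.\<close>

lemma DERIV_mzv_series_Plain_Suc:
  assumes "p \<ge> 1" "pos_weights s" "\<bar>x\<bar> < 1" "x \<noteq> 0"
  shows "(mzv_series (Plain (Suc p) # s) has_field_derivative mzv_series (Plain p # s) x / x) (at x)"
proof -
  have *: "diffs (mzv_coeff (Plain (Suc p) # s)) n = mzv_coeff (Plain p # s) (Suc n)" for n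
    by (simp add: diffs_def divide_simps)
  have "summable (\<lambda>n. mzv_coeff (Plain p # s) n * x ^ n)"
    using assms by (intro summable_mzv_series) auto
  from suminf_split_head[OF this]
  have "mzv_series (Plain p # s) x = (\<Sum>n. mzv_coeff (Plain p # s) (Suc n) * x ^ Suc n)"
    using assms(1) by (simp add: mzv_series_def power_0_left)
  also have "\<dots> = (\<Sum>n. x * (diffs (mzv_coeff (Plain (Suc p) # s)) n * x ^ n))"
    unfolding * by (simp add: mult_ac)
  also have "\<dots> = x * (\<Sum>n. diffs (mzv_coeff (Plain (Suc p) # s)) n * x ^ n)"
    using assms by (intro suminf_mult summable_diffs_mzv_coeff) auto
  finally have "(\<Sum>n. diffs (mzv_coeff (Plain (Suc p) # s)) n * x ^ n) = mzv_series (Plain p # s) x / x"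
    using assms by simp
  then show ?thesis using DERIV_mzv_series[of "Plain (Suc p) # s" x] assms by simp
qed

text \<open>The derivative has the truncated sums of s as coefficients. These are partial sums of
  the coefficients of s, so multiplication by 1 - x telescopes them back to
  \<open>mzv_series s\<close>.\<close>

lemma DERIV_mzv_series_Plain_1:
  assumes "pos_weights s" "\<bar>x\<bar> < 1"
  shows "(mzv_series (Plain 1 # s) has_field_derivative mzv_series s x / (1 - x)) (at x)"
proof -
  let ?T = "alt_mzv_trunc s"
  have *: "diffs (mzv_coeff (Plain 1 # s)) n = ?T n" for n
    by (simp add: diffs_def divide_simps)
  have sT: "summable (\<lambda>n. ?T n * x ^ n)"
    using summable_diffs_mzv_coeff[of "Plain 1 # s" x] assms unfolding * by simp
  have T0: "?T 0 = mzv_coeff s 0" and T: "?T (Suc n) - ?T n = mzv_coeff s (Suc n)" for n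
    using assms by (simp_all add: alt_mzv_trunc_eq_sum_coeff)
  have sT': "summable (\<lambda>n. ?T (Suc n) * x ^ Suc n)"
    using sT by (subst summable_Suc_iff)
  have sTx: "summable (\<lambda>n. x * (?T n * x ^ n))" by (intro summable_mult sT)
  have "(\<Sum>n. ?T n * x ^ n) - x * (\<Sum>n. ?T n * x ^ n)
      = ?T 0 + ((\<Sum>n. ?T (Suc n) * x ^ Suc n) - (\<Sum>n. x * (?T n * x ^ n)))"
    using suminf_split_head[OF sT] suminf_mult[OF sT, of x] by simp
  also have "(\<Sum>n. ?T (Suc n) * x ^ Suc n) - (\<Sum>n. x * (?T n * x ^ n))
      = (\<Sum>n. ?T (Suc n) * x ^ Suc n - x * (?T n * x ^ n))"
    by (rule suminf_diff[OF sT' sTx])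
  also have "\<dots> = (\<Sum>n. mzv_coeff s (Suc n) * x ^ Suc n)"
    by (simp flip: T add: algebra_simps)
  also have "?T 0 + \<dots> = mzv_series s x"
    using suminf_split_head[OF summable_mzv_series[OF assms]] by (simp add: mzv_series_def T0)
  finally have "(\<Sum>n. ?T n * x ^ n) = mzv_series s x / (1 - x)"
    using assms by (simp add: field_simps)
  then show ?thesis using DERIV_mzv_series[of "Plain 1 # s" x] assms unfolding * by simp
qed

section \<open>Closed forms of the generating functions\<close>

lemma eq_if_DERIV_eq:
  fixes f g :: "real \<Rightarrow> real"
  assumes "\<And>x. \<bar>x\<bar> < 1 \<Longrightarrow> (f has_field_derivative h x) (at x)"
    and "\<And>x. \<bar>x\<bar> < 1 \<Longrightarrow> (g has_field_derivative h x) (at x)"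
    and "f 0 = g 0" "\<bar>x\<bar> < 1"
  shows "f x = g x"
proof -
  have "f x - g x = f 0 - g 0"
  proof (rule DERIV_isconst3[where f = "\<lambda>x. f x - g x" and a = "-1" and b = 1])
    fix y :: real assume "y \<in> {-1<..<1}"
    then have "\<bar>y\<bar> < 1" by auto
    then show "((\<lambda>x. f x - g x) has_field_derivative 0) (at y)"
      using DERIV_diff[OF assms(1,2)] by fastforce
  qed (use assms(4) in auto)
  with assms(3) show ?thesis by simp
qed

text \<open>Derivatives are compared at positive points only, and continuity carries the equality to
  0. This suits the integrand ln^q(1 + t)/t, whose formula divides by t.\<close>

lemma eq_if_DERIV_eq_right:
  fixes f g :: "real \<Rightarrow> real"
  assumes "\<And>x. 0 \<le> x \<Longrightarrow> x < 1 \<Longrightarrow> isCont f x" "\<And>x. 0 \<le> x \<Longrightarrow> x < 1 \<Longrightarrow> isCont g x"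
    and "\<And>x. 0 < x \<Longrightarrow> x < 1 \<Longrightarrow> (f has_field_derivative h x) (at x)"
    and "\<And>x. 0 < x \<Longrightarrow> x < 1 \<Longrightarrow> (g has_field_derivative h x) (at x)"
    and "f 0 = g 0" "0 \<le> x" "x < 1"
  shows "f x = g x"
proof (cases "x = 0")
  case False
  have "f x - g x = f 0 - g 0"
  proof (rule DERIV_isconst_end[where f = "\<lambda>x. f x - g x"])
    show "continuous_on {0..x} (\<lambda>x. f x - g x)"
      using assms by (intro continuous_at_imp_continuous_on ballI continuous_diff) auto
    fix y assume "0 < y" "y < x"
    then show "((\<lambda>x. f x - g x) has_field_derivative 0) (at y)"
      using DERIV_diff[OF assms(3,4), of y] assms by simp
  qed (use False assms in auto)
  with assms show ?thesis by simp
qed (use assms in simp)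

text \<open>Each prepended 1 integrates against dx/(1 - x), the differential of -ln (1 - x),
  starting from the constant 1.\<close>

lemma mzv_series_ones:
  assumes "\<bar>x\<bar> < 1"
  shows "mzv_series (replicate k (Plain 1)) x = (- ln (1 - x)) ^ k / fact k"
  using assms
proof (induction k arbitrary: x)
  case 0
  then show ?case by (simp add: mzv_series_Nil)
next
  case (Suc k)
  show ?case
  proof (rule eq_if_DERIV_eq[OF _ _ _ Suc.prems])
    fix y :: real assume y: "\<bar>y\<bar> < 1"
    show "(mzv_series (replicate (Suc k) (Plain 1)) has_field_derivative
        mzv_series (replicate k (Plain 1)) y / (1 - y)) (at y)"
      using DERIV_mzv_series_Plain_1[OF _ y, of "replicate k (Plain 1)"] by simp
    show "((\<lambda>y. (- ln (1 - y)) ^ Suc k / fact (Suc k)) has_field_derivative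
        mzv_series (replicate k (Plain 1)) y / (1 - y)) (at y)"
      unfolding Suc.IH[OF y] using y
      by (auto intro!: derivative_eq_intros simp del: power_Suc)
  qed (simp_all add: mzv_series_0)
qed

section \<open>Polylogarithms as depth-one series\<close>

lemma polylog_eq_mzv_series:
  assumes "p \<ge> 1" "\<bar>x\<bar> < 1"
  shows "polylog p x = mzv_series [Plain p] x"
proof -
  have "summable (\<lambda>n. mzv_coeff [Plain p] n * x ^ n)"
    using assms by (intro summable_mzv_series) auto
  from suminf_split_head[OF this] show ?thesis
    using assms by (simp add: mzv_series_def polylog_def alt_mzv_trunc_Nil power_0_left)
qed

text \<open>A geometric series. Weight 0 is kept so that the derivative rule for polylogarithms also
  covers weight 1.\<close>

lemma polylog_0:
  assumes "\<bar>x\<bar> < 1"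
  shows "polylog 0 x = x / (1 - x)"
  using suminf_mult[OF summable_geometric, of x x] suminf_geometric[of x] assms
  by (simp add: polylog_def)

lemma polylog_1:
  assumes "\<bar>x\<bar> < 1"
  shows "polylog 1 x = - ln (1 - x)"
  using polylog_eq_mzv_series[of 1 x] mzv_series_ones[of x 1] assms by simp

lemma DERIV_polylog:
  assumes "\<bar>x\<bar> < 1" "x \<noteq> 0"
  shows "(polylog (Suc p) has_field_derivative polylog p x / x) (at x)"
proof -
  \<comment> \<open>The identification with \<open>mzv_series\<close> is available on the open unit
    interval; a neighbourhood of x suffices to transfer the derivative.\<close>
  have "\<forall>\<^sub>F y in nhds x. y \<in> {-1<..<1}"
    by (rule eventually_nhds_in_open) (use assms(1) in auto)
  then have ev: "\<forall>\<^sub>F y in nhds x. \<bar>y\<bar> < 1"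
    by eventually_elim auto
  have eq: "\<forall>\<^sub>F y in nhds x. polylog (Suc p) y = mzv_series [Plain (Suc p)] y"
    using ev by eventually_elim (simp add: polylog_eq_mzv_series)
  have "(mzv_series [Plain (Suc p)] has_field_derivative polylog p x / x) (at x)"
  proof (cases "p = 0")
    case True
    then show ?thesis
      using DERIV_mzv_series_Plain_1[of "[]" x] assms by (simp add: polylog_0 mzv_series_Nil)
  next
    case False
    then show ?thesis
      using DERIV_mzv_series_Plain_Suc[of p "[]" x] assms by (simp add: polylog_eq_mzv_series)
  qed
  then show ?thesis by (subst DERIV_cong_ev[OF refl eq refl])
qed

lemmas DERIV_polylog_chain [derivative_intros] = DERIV_chain2[OF DERIV_polylog]

text \<open>Since \<Lambda>^j/j! differentiates to \<Lambda>^(j-1)/(j-1)! divided by 1 + t, the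
  first sum is the convolution for m - 1 over 1 + t. This matches, up to sign, the equation for a
  prepended 1 at -t, provided that the second sum can be dealt with.\<close>

lemma DERIV_ln_powers_convolution:
  fixes g :: "nat \<Rightarrow> real \<Rightarrow> real"
  assumes "t > -1" "\<And>i. i \<le> m \<Longrightarrow> (g i has_field_derivative g' i) (at t)"
  shows "((\<lambda>t. \<Sum>j\<le>m. ln (1 + t) ^ j / fact j * g (m - j) t) has_field_derivative
      (\<Sum>j<m. ln (1 + t) ^ j / fact j * g (m - Suc j) t) / (1 + t)
      + (\<Sum>j\<le>m. ln (1 + t) ^ j / fact j * g' (m - j))) (at t)"
proof -
  have l: "((\<lambda>t. ln (1 + t) ^ j / fact j) has_field_derivative
      (case j of 0 \<Rightarrow> 0 | Suc i \<Rightarrow> ln (1 + t) ^ i / fact i / (1 + t))) (at t)" for j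
    using assms(1)
    by (cases j) (auto intro!: derivative_eq_intros simp del: power_Suc simp: divide_simps)
  have "((\<lambda>t. \<Sum>j\<le>m. ln (1 + t) ^ j / fact j * g (m - j) t) has_field_derivative
      (\<Sum>j\<le>m. (case j of 0 \<Rightarrow> 0 | Suc i \<Rightarrow> ln (1 + t) ^ i / fact i / (1 + t)) * g (m - j) t
        + g' (m - j) * (ln (1 + t) ^ j / fact j))) (at t)"
    by (intro DERIV_sum DERIV_mult l assms(2)) auto
  also have "(\<Sum>j\<le>m. (case j of 0 \<Rightarrow> 0 | Suc i \<Rightarrow> ln (1 + t) ^ i / fact i / (1 + t)) * g (m - j) t
        + g' (m - j) * (ln (1 + t) ^ j / fact j))
      = (\<Sum>j\<le>m. (case j of 0 \<Rightarrow> 0 | Suc i \<Rightarrow> ln (1 + t) ^ i / fact i / (1 + t)) * g (m - j) t)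
        + (\<Sum>j\<le>m. ln (1 + t) ^ j / fact j * g' (m - j))"
    by (simp add: sum.distrib mult.commute)
  also have "(\<Sum>j\<le>m. (case j of 0 \<Rightarrow> 0 | Suc i \<Rightarrow> ln (1 + t) ^ i / fact i / (1 + t)) * g (m - j) t)
      = (\<Sum>j<m. ln (1 + t) ^ j / fact j * g (m - Suc j) t) / (1 + t)"
    by (simp add: sum.atMost_shift sum_divide_distrib)
  finally show ?thesis .
qed

text \<open>Induction on m by comparing derivatives. The argument (1 + t)/2 has logarithmic
  derivative 1/(1 + t), so the first polylogarithm drops one weight and acquires the factor 1/(1 +
  t). The constants at 1/2 make the right-hand side vanish at t = 0.\<close>

lemma mzv_series_ones_Bar:
  assumes "\<bar>t\<bar> < 1"
  shows "mzv_series (replicate m (Plain 1) @ [Bar 1]) (- t) =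
    (-1) ^ m * (polylog (Suc m) ((1 + t) / 2)
      - (\<Sum>j\<le>m. ln (1 + t) ^ j / fact j * polylog (Suc (m - j)) (1 / 2)))"
  using assms
proof (induction m arbitrary: t)
  case 0
  have "mzv_series [Bar 1] (- t) = - ln (1 - t)"
    using mzv_series_ones[of t 1] 0 by (simp add: mzv_series_Bar)
  moreover have "polylog 1 ((1 + t) / 2) = - ln (1 - (1 + t) / 2)"
    using 0 by (intro polylog_1) auto
  moreover have "1 - (1 + t) / 2 = (1 - t) / 2" by (simp add: field_simps)
  moreover have "ln ((1 - t) / 2) = ln (1 - t) - ln 2" using 0 by (subst ln_divide_pos) auto
  moreover have "polylog 1 (1 / 2) = ln 2" by (subst polylog_1) (auto simp: ln_div)
  ultimately show ?case by simp
next
  case (Suc m)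
  let ?s = "replicate m (Plain 1) @ [Bar 1]"
  show ?case
  proof (rule eq_if_DERIV_eq[OF _ _ _ Suc.prems, where h = "\<lambda>t. - (mzv_series ?s (- t) / (1 + t))"])
    fix y :: real assume y: "\<bar>y\<bar> < 1"
    have "(mzv_series (Plain 1 # ?s) has_field_derivative mzv_series ?s (- y) / (1 - - y)) (at (- y))"
      using y by (intro DERIV_mzv_series_Plain_1) auto
    then have "((\<lambda>t. mzv_series (Plain 1 # ?s) (- t)) has_field_derivative
        mzv_series ?s (- y) / (1 - - y) * - 1) (at y)"
      by (rule DERIV_chain2) (auto intro!: derivative_eq_intros)
    then show "((\<lambda>t. mzv_series (replicate (Suc m) (Plain 1) @ [Bar 1]) (- t)) has_field_derivative
        - (mzv_series ?s (- y) / (1 + y))) (at y)" by simp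
    \<comment> \<open>The convolved functions are constant here, so only the first sum of the
      product rule survives.\<close>
    have "((\<lambda>t. \<Sum>j\<le>Suc m. ln (1 + t) ^ j / fact j * polylog (Suc (Suc m - j)) (1 / 2))
        has_field_derivative
        (\<Sum>j\<le>m. ln (1 + y) ^ j / fact j * polylog (Suc (m - j)) (1 / 2)) / (1 + y)) (at y)"
      using DERIV_ln_powers_convolution[of y "Suc m" "\<lambda>i t. polylog (Suc i) (1 / 2)" "\<lambda>i. 0"] y
      by (simp add: lessThan_Suc_atMost del: sum.atMost_Suc)
    moreover have "((\<lambda>t. polylog (Suc (Suc m)) ((1 + t) / 2)) has_field_derivative
        polylog (Suc m) ((1 + y) / 2) / (1 + y)) (at y)"
      using y by (auto intro!: derivative_eq_intros simp: divide_simps)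
    ultimately have "((\<lambda>t. (-1) ^ Suc m * (polylog (Suc (Suc m)) ((1 + t) / 2)
        - (\<Sum>j\<le>Suc m. ln (1 + t) ^ j / fact j * polylog (Suc (Suc m - j)) (1 / 2)))) has_field_derivative
        (-1) ^ Suc m * (polylog (Suc m) ((1 + y) / 2) / (1 + y)
        - (\<Sum>j\<le>m. ln (1 + y) ^ j / fact j * polylog (Suc (m - j)) (1 / 2)) / (1 + y))) (at y)"
      by (intro DERIV_cmult DERIV_diff)
    then show "((\<lambda>t. (-1) ^ Suc m * (polylog (Suc (Suc m)) ((1 + t) / 2)
        - (\<Sum>j\<le>Suc m. ln (1 + t) ^ j / fact j * polylog (Suc (Suc m - j)) (1 / 2)))) has_field_derivative
        - (mzv_series ?s (- y) / (1 + y))) (at y)"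
      unfolding Suc.IH[OF y] by (simp add: diff_divide_distrib right_diff_distrib del: sum.atMost_Suc)
  next
    show "mzv_series (replicate (Suc m) (Plain 1) @ [Bar 1]) (- 0) =
      (-1) ^ Suc m * (polylog (Suc (Suc m)) ((1 + 0) / 2)
        - (\<Sum>j\<le>Suc m. ln (1 + 0) ^ j / fact j * polylog (Suc (Suc m - j)) (1 / 2)))"
      by (simp add: mzv_series_0 sum.atMost_Suc_shift del: sum.atMost_Suc)
  qed
qed

text \<open>This is the integral of \<open>ln\<^sup>q(1 + s)/s\<close> over \<open>[0, t]\<close>, for \<open>q \<ge> 1\<close>; defining it through
  the series gives continuity at \<open>0\<close> for free.\<close>

definition ln_power_integral :: "nat \<Rightarrow> real \<Rightarrow> real" where
  "ln_power_integral q t = (-1) ^ q * fact q * mzv_series (Plain 2 # replicate (q - 1) (Plain 1)) (- t)"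

lemma ln_power_integral_0: "ln_power_integral q 0 = 0"
  by (simp add: ln_power_integral_def mzv_series_0)

lemma isCont_ln_power_integral:
  assumes "\<bar>t\<bar> < 1"
  shows "isCont (ln_power_integral q) t"
proof -
  let ?s = "Plain 2 # replicate (q - 1) (Plain 1)"
  have "isCont (mzv_series ?s) (- t)"
    by (rule DERIV_isCont[OF DERIV_mzv_series]) (use assms in auto)
  then have "isCont (\<lambda>t. mzv_series ?s (- t)) t"
    by (rule isCont_o2[rotated]) simp
  then show ?thesis unfolding ln_power_integral_def[abs_def] by simp
qed

text \<open>Lowering the leading 2 leaves q ones, whose series is a power of the logarithm; the
  normalisation of \<open>ln_power_integral\<close> removes the sign and the factorial.\<close>

lemma DERIV_ln_power_integral:
  assumes "q \<ge> 1" "0 < t" "t < 1"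
  shows "(ln_power_integral q has_field_derivative ln (1 + t) ^ q / t) (at t)"
proof -
  let ?s = "replicate (q - 1) (Plain 1)"
  have eq: "mzv_series (Plain 1 # ?s) (- t) = (- ln (1 + t)) ^ q / fact q"
    using mzv_series_ones[of "- t" q] assms by (cases q) auto
  have "(mzv_series (Plain 2 # ?s) has_field_derivative
      mzv_series (Plain 1 # ?s) (- t) / (- t)) (at (- t))"
    using DERIV_mzv_series_Plain_Suc[of 1 ?s "- t"] assms by (simp add: numeral_2_eq_2)
  then have "((\<lambda>t. mzv_series (Plain 2 # ?s) (- t)) has_field_derivative
      mzv_series (Plain 1 # ?s) (- t) / (- t) * - 1) (at t)"
    by (rule DERIV_chain2) (auto intro!: derivative_eq_intros)
  then have "(ln_power_integral q has_field_derivative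
      (-1) ^ q * fact q * (mzv_series (Plain 1 # ?s) (- t) / (- t) * - 1)) (at t)"
    unfolding ln_power_integral_def[abs_def] by (rule DERIV_cmult)
  also have "(-1) ^ q * fact q * (mzv_series (Plain 1 # ?s) (- t) / (- t) * - 1) = ln (1 + t) ^ q / t"
    unfolding eq power_minus[of "ln (1 + t)" q] by simp
  finally show ?thesis .
qed

text \<open>The binomial expansion of (1 - 1)^m, divided by m!.\<close>

lemma alternating_sum_inverse_fact:
  assumes "m \<ge> 1"
  shows "(\<Sum>j\<le>m. (-1) ^ (m - j) / (fact j * fact (m - j)) :: real) = 0"
proof -
  have "0 = (1 + (-1 :: real)) ^ m" using assms by simp
  also have "\<dots> = (\<Sum>j\<le>m. fact m * ((-1) ^ (m - j) / (fact j * fact (m - j))))"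
    unfolding binomial_ring by (intro sum.cong) (auto simp: binomial_fact)
  finally have "fact m * (\<Sum>j\<le>m. (-1) ^ (m - j) / (fact j * fact (m - j))) = (0 :: real)"
    by (simp only: sum_distrib_left)
  then show ?thesis by simp
qed

text \<open>Induction on m. The convolution with g_i = (-1)^i P_(k+i) / (k! i!) differentiates to
  its predecessor over 1 + t plus a multiple of \<Lambda>^(k+m)/t, whose coefficient is the
  alternating binomial sum and hence 0 for m \<ge> 1. Both sides vanish at 0.\<close>

lemma mzv_series_ones_2_ones:
  assumes "k \<ge> 1" "0 \<le> t" "t < 1"
  shows "mzv_series (replicate m (Plain 1) @ Plain 2 # replicate (k - 1) (Plain 1)) (- t) =
    (-1) ^ (m + k) * (\<Sum>j\<le>m. ln (1 + t) ^ j / fact j *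
      ((-1) ^ (m - j) / (fact k * fact (m - j)) * ln_power_integral (k + (m - j)) t))"
  using assms(2,3)
proof (induction m arbitrary: t)
  case 0
  show ?case by (simp add: ln_power_integral_def flip: power_mult_distrib)
next
  case (Suc m)
  let ?s = "replicate m (Plain 1) @ Plain 2 # replicate (k - 1) (Plain 1)"
  let ?g = "\<lambda>i t. (-1) ^ i / (fact k * fact i) * ln_power_integral (k + i) t"
  let ?S = "\<lambda>m t. \<Sum>j\<le>m. ln (1 + t) ^ j / fact j * ?g (m - j) t"
  have lhs: "((\<lambda>t. mzv_series (Plain 1 # ?s) (- t)) has_field_derivative
        - (mzv_series ?s (- y) / (1 + y))) (at y)" if "0 \<le> y" "y < 1" for y
  proof -
    have "(mzv_series (Plain 1 # ?s) has_field_derivative mzv_series ?s (- y) / (1 - - y)) (at (- y))"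
      using that by (intro DERIV_mzv_series_Plain_1) auto
    then have "((\<lambda>t. mzv_series (Plain 1 # ?s) (- t)) has_field_derivative
        mzv_series ?s (- y) / (1 - - y) * - 1) (at y)"
      by (rule DERIV_chain2) (auto intro!: derivative_eq_intros)
    then show ?thesis by simp
  qed
  have "mzv_series (Plain 1 # ?s) (- t) = (-1) ^ (Suc m + k) * ?S (Suc m) t"
  proof (rule eq_if_DERIV_eq_right[OF _ _ _ _ _ Suc.prems,
        where f = "\<lambda>t. mzv_series (Plain 1 # ?s) (- t)" and g = "\<lambda>t. (-1) ^ (Suc m + k) * ?S (Suc m) t"])
    fix y :: real assume y: "0 \<le> y" "y < 1"
    show "isCont (\<lambda>t. mzv_series (Plain 1 # ?s) (- t)) y"
      by (rule DERIV_isCont[OF lhs[OF y]])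
    have "isCont (ln_power_integral i) y" for i
      using y by (intro isCont_ln_power_integral) auto
    then show "isCont (\<lambda>t. (-1) ^ (Suc m + k) * ?S (Suc m) t) y"
      using y by (intro continuous_intros) auto
  next
    fix y :: real assume y: "0 < y" "y < 1"
    show "((\<lambda>t. mzv_series (Plain 1 # ?s) (- t)) has_field_derivative
        - (mzv_series ?s (- y) / (1 + y))) (at y)"
      using lhs y by simp
    have "(?g i has_field_derivative (-1) ^ i / (fact k * fact i) * (ln (1 + y) ^ (k + i) / y)) (at y)" for i
      using y assms(1) by (intro DERIV_cmult DERIV_ln_power_integral) auto
    then have "(?S (Suc m) has_field_derivative
        (\<Sum>j<Suc m. ln (1 + y) ^ j / fact j * ?g (Suc m - Suc j) y) / (1 + y)
        + (\<Sum>j\<le>Suc m. ln (1 + y) ^ j / fact j * ((-1) ^ (Suc m - j) / (fact k * fact (Suc m - j))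
            * (ln (1 + y) ^ (k + (Suc m - j)) / y)))) (at y)"
      using y by (intro DERIV_ln_powers_convolution[where g = ?g]) auto
    \<comment> \<open>The two powers of the logarithm combine to an exponent independent of j and
      can be factored out.\<close>
    also have "(\<Sum>j\<le>Suc m. ln (1 + y) ^ j / fact j * ((-1) ^ (Suc m - j) / (fact k * fact (Suc m - j))
            * (ln (1 + y) ^ (k + (Suc m - j)) / y)))
        = (\<Sum>j\<le>Suc m. ln (1 + y) ^ (k + Suc m) / (fact k * y)
            * ((-1) ^ (Suc m - j) / (fact j * fact (Suc m - j))))"
    proof (intro sum.cong refl)
      fix j assume "j \<in> {..Suc m}"
      then have "ln (1 + y) ^ (k + Suc m) = ln (1 + y) ^ j * ln (1 + y) ^ (k + (Suc m - j))"
        by (simp flip: power_add)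
      then show "ln (1 + y) ^ j / fact j * ((-1) ^ (Suc m - j) / (fact k * fact (Suc m - j))
            * (ln (1 + y) ^ (k + (Suc m - j)) / y)) = ln (1 + y) ^ (k + Suc m) / (fact k * y)
            * ((-1) ^ (Suc m - j) / (fact j * fact (Suc m - j)))"
        by (simp only: times_divide_eq_left times_divide_eq_right divide_divide_eq_left mult_ac)
    qed
    also have "\<dots> = 0"
      unfolding sum_distrib_left[symmetric] by (subst alternating_sum_inverse_fact) auto
    finally have "((\<lambda>t. (-1) ^ (Suc m + k) * ?S (Suc m) t) has_field_derivative
        (-1) ^ (Suc m + k) * (?S m y / (1 + y))) (at y)"
      by (intro DERIV_cmult) (simp add: lessThan_Suc_atMost del: sum.atMost_Suc)
    then show "((\<lambda>t. (-1) ^ (Suc m + k) * ?S (Suc m) t) has_field_derivative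
        - (mzv_series ?s (- y) / (1 + y))) (at y)"
      using Suc.IH[of y] y by (simp del: sum.atMost_Suc)
  next
    show "mzv_series (Plain 1 # ?s) (- 0) = (-1) ^ (Suc m + k) * ?S (Suc m) 0"
      by (simp add: mzv_series_0 ln_power_integral_0 del: sum.atMost_Suc)
  qed
  then show ?case by simp
qed

section \<open>Abel summation at the boundary\<close>

text \<open>By the M-test the convergence is uniform on [0, 1], so the sum is continuous up to the
  endpoint.\<close>

lemma tendsto_power_series_at_left_1:
  fixes a :: "nat \<Rightarrow> real"
  assumes "summable (\<lambda>n. \<bar>a n\<bar>)"
  shows "((\<lambda>x. \<Sum>n. a n * x ^ n) \<longlongrightarrow> suminf a) (at_left 1)"
proof -
  have lim: "uniform_limit {0..1} (\<lambda>N x. \<Sum>n<N. a n * x ^ n) (\<lambda>x. \<Sum>n. a n * x ^ n) sequentially"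
  proof (rule Weierstrass_m_test)
    fix n and x :: real assume "x \<in> {0..1}"
    then show "norm (a n * x ^ n) \<le> \<bar>a n\<bar>"
      by (auto simp: abs_mult intro!: mult_left_le power_le_one)
  qed (fact assms)
  have "continuous_on {0..1} (\<lambda>x. \<Sum>n. a n * x ^ n)"
    by (rule uniform_limit_theorem[OF _ lim])
       (auto intro!: always_eventually continuous_intros)
  then have "((\<lambda>x. \<Sum>n. a n * x ^ n) \<longlongrightarrow> (\<Sum>n. a n * 1 ^ n)) (at 1 within {0..1})"
    unfolding continuous_on_def by (rule bspec) simp
  then show ?thesis by (simp add: at_within_Icc_at_left)
qed

text \<open>Multiplying by \<open>1 + x\<close> turns a conditionally convergent alternating series into an
  absolutely convergent one.\<close>

lemma Abel_alternating:
  fixes c :: "nat \<Rightarrow> real"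
  assumes pairs: "summable (\<lambda>n. \<bar>c (Suc n) + c n\<bar>)" and "c \<longlonglongrightarrow> 0"
    and sm: "\<And>x. \<bar>x\<bar> < 1 \<Longrightarrow> summable (\<lambda>n. c n * x ^ n)"
  obtains l where "c sums l" "((\<lambda>x. \<Sum>n. c n * x ^ n) \<longlongrightarrow> l) (at_left 1)"
proof -
  \<comment> \<open>These are the coefficients of (1 + x) times the power series of c.\<close>
  define a where "a n = (case n of 0 \<Rightarrow> c 0 | Suc n \<Rightarrow> c (Suc n) + c n)" for n
  have a_simps [simp]: "a 0 = c 0" "a (Suc n) = c (Suc n) + c n" for n
    by (simp_all add: a_def)
  have sa: "summable (\<lambda>n. \<bar>a n\<bar>)"
    using pairs by (subst summable_Suc_iff[symmetric]) simp
  \<comment> \<open>Every c n enters twice except the last, which tends to 0; hence the partial sums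
    of c converge to half the sum of a. The same half arises below from dividing by 1 + x at x =
    1.\<close>
  have "(\<Sum>n<N. a n) = 2 * (\<Sum>n<N. c n) - (if N = 0 then 0 else c (N - 1))" for N
    by (induction N) (auto simp: a_def split: nat.splits)
  then have "(\<lambda>N. \<Sum>n<Suc N. c n) = (\<lambda>N. ((\<Sum>n<Suc N. a n) + c N) / 2)"
    by (simp add: fun_eq_iff del: sum.lessThan_Suc)
  moreover have "(\<lambda>N. ((\<Sum>n<Suc N. a n) + c N) / 2) \<longlonglongrightarrow> (suminf a + 0) / 2"
    using summable_LIMSEQ[OF summable_rabs_cancel[OF sa]] assms(2)
    by (intro tendsto_intros filterlim_compose[OF _ filterlim_Suc]) auto
  ultimately have "(\<lambda>N. \<Sum>n<Suc N. c n) \<longlonglongrightarrow> suminf a / 2"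
    by (simp only: add_0_right)
  then have 1: "c sums (suminf a / 2)"
    unfolding sums_def by (rule LIMSEQ_imp_Suc)
  have eq: "(\<Sum>n. a n * x ^ n) / (1 + x) = (\<Sum>n. c n * x ^ n)" if x: "\<bar>x\<bar> < 1" for x
  proof -
    have s1: "summable (\<lambda>n. c (Suc n) * x ^ Suc n)"
      using sm[OF x] by (subst summable_Suc_iff)
    have s2: "summable (\<lambda>n. x * (c n * x ^ n))" by (intro summable_mult sm x)
    have s3: "summable (\<lambda>n. a (Suc n) * x ^ Suc n)"
      using summable_add[OF s1 s2] by (simp add: algebra_simps)
    then have "summable (\<lambda>n. a n * x ^ n)" by (subst (asm) summable_Suc_iff)
    from suminf_split_head[OF this]
    have "(\<Sum>n. a n * x ^ n) = c 0 + (\<Sum>n. a (Suc n) * x ^ Suc n)" by simp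
    also have "(\<Sum>n. a (Suc n) * x ^ Suc n) = (\<Sum>n. c (Suc n) * x ^ Suc n + x * (c n * x ^ n))"
      by (simp add: algebra_simps)
    also have "\<dots> = (\<Sum>n. c (Suc n) * x ^ Suc n) + x * (\<Sum>n. c n * x ^ n)"
      by (simp only: suminf_add[OF s1 s2, symmetric] suminf_mult[OF sm[OF x]])
    also have "c 0 + \<dots> = (1 + x) * (\<Sum>n. c n * x ^ n)"
      using suminf_split_head[OF sm[OF x]] by (simp add: algebra_simps)
    finally show ?thesis using x by simp
  qed
  have "((\<lambda>x. (\<Sum>n. a n * x ^ n) / (1 + x)) \<longlongrightarrow> suminf a / (1 + 1)) (at_left 1)"
    by (intro tendsto_intros tendsto_power_series_at_left_1 sa) auto
  moreover have "\<forall>\<^sub>F x :: real in at_left 1. x \<in> {0<..<1}"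
    by (intro eventually_at_left_real) auto
  then have "\<forall>\<^sub>F x in at_left 1. (\<Sum>n. a n * x ^ n) / (1 + x) = (\<Sum>n. c n * x ^ n)"
    by eventually_elim (intro eq, auto)
  ultimately have "((\<lambda>x. \<Sum>n. c n * x ^ n) \<longlongrightarrow> suminf a / (1 + 1)) (at_left 1)"
    by (rule Lim_transform_eventually)
  with 1 show ?thesis by (intro that[of "suminf a / 2"]) auto
qed

text \<open>Up to sign the coefficients are T(n - 1)/n, where T is the truncated sum of s.
  Neighbouring terms nearly cancel, leaving O(n^(-3/2)), so the Abel argument shows that the
  truncations converge, to the same limit as the series at -t.\<close>

lemma alt_mzv_Bar_1:
  assumes s: "pos_weights s" "s \<noteq> []"
    and lim: "((\<lambda>t. mzv_series (Plain 1 # s) (- t)) \<longlongrightarrow> L) (at_left 1)"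
  shows "alt_mzv (Bar 1 # s) = L"
proof -
  define c where "c = mzv_coeff (Bar 1 # s)"
  define C where "C = (2 :: real) ^ length s"
  have C: "C > 0" by (simp add: C_def)
  have pos: "pos_weights (Bar 1 # s)" using s by simp
  have c0: "c 0 = 0" by (simp add: c_def)
  have diff: "\<bar>c (Suc n) + c n\<bar> \<le> 2 * C * real n powr - (3 / 2)" for n
  proof (cases "n = 0")
    \<comment> \<open>Here \<open>real 0 powr - (3 / 2)\<close> is 0, so an exact zero is required:
      c 1 is minus the empty truncated sum, which is 0 because s is nonempty.\<close>
    case True
    then show ?thesis using s by (cases s) (auto simp: c_def alt_mzv_trunc_Cons)
  next
    case False
    define T T' where "T = alt_mzv_trunc s n" and "T' = alt_mzv_trunc s (n - 1)"
    obtain n' where n': "n = Suc n'" using False by (cases n) auto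
    have TT: "T = T' + mzv_coeff s n"
      using s(1) n' by (simp add: T_def T'_def alt_mzv_trunc_eq_sum_coeff)
    have "c (Suc n) + c n = (-1) ^ n * (T' / real n - T / real (Suc n))"
      using n' by (simp add: c_def T_def T'_def algebra_simps)
    \<comment> \<open>Separates the change of the denominator from the jump of T. The sqrt n bound
      for T' and the 1/sqrt n bound for the coefficient make both parts O(n^(-3/2)).\<close>
    also have "T' / real n - T / real (Suc n) = T' / (real n * real (Suc n)) - mzv_coeff s n / real (Suc n)"
      using False unfolding TT by (simp add: divide_simps) (simp add: algebra_simps)
    finally have "\<bar>c (Suc n) + c n\<bar> \<le> \<bar>T'\<bar> / (real n * real (Suc n)) + \<bar>mzv_coeff s n\<bar> / real (Suc n)"
      by (simp add: abs_mult abs_divide order_trans[OF abs_triangle_ineq4])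
    also have "\<dots> \<le> C * sqrt (real n) / (real n * real n) + (C / sqrt (real n)) / real n"
      using abs_alt_mzv_trunc_le[OF s(1), of "n - 1"] abs_mzv_coeff_le[OF s(1), of n] n' C
      by (intro add_mono frac_le mult_mono) (auto simp: C_def T'_def)
    also have "\<dots> = 2 * C * real n powr - (3 / 2)"
    proof -
      define r where "r = sqrt (real n)"
      have r: "r > 0" "real n = r * r" using False by (simp_all add: r_def)
      have "real n powr (3 / 2) = real n powr (1 + 1 / 2)" by simp
      also have "\<dots> = real n * r"
        using False by (subst powr_add) (simp add: powr_half_sqrt r_def)
      finally have "real n powr - (3 / 2) = 1 / (real n * r)"
        by (simp only: powr_minus_divide)
      then show ?thesis using r(1) unfolding r_def[symmetric] by (simp add: r(2) field_simps)
    qed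
    finally show ?thesis .
  qed
  have "summable (\<lambda>n. \<bar>c (Suc n) + c n\<bar>)"
  proof (rule summable_comparison_test)
    show "\<exists>N. \<forall>n\<ge>N. norm \<bar>c (Suc n) + c n\<bar> \<le> 2 * C * real n powr - (3 / 2)"
      using diff by simp
    show "summable (\<lambda>n. 2 * C * real n powr - (3 / 2))"
      by (intro summable_mult) (simp add: summable_real_powr_iff)
  qed
  moreover have "c \<longlonglongrightarrow> 0"
  proof (rule Lim_null_comparison)
    show "\<forall>\<^sub>F n in sequentially. norm (c n) \<le> 2 * C / sqrt (real n)"
      using eventually_ge_at_top[of 1]
      by eventually_elim (use abs_mzv_coeff_le[OF pos] in \<open>simp add: c_def C_def\<close>)
    show "(\<lambda>n. 2 * C / sqrt (real n)) \<longlonglongrightarrow> 0" by real_asymp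
  qed
  moreover have "summable (\<lambda>n. c n * x ^ n)" if "\<bar>x\<bar> < 1" for x
    unfolding c_def using pos that by (rule summable_mzv_series)
  ultimately obtain l where l: "c sums l" "((\<lambda>x. \<Sum>n. c n * x ^ n) \<longlongrightarrow> l) (at_left 1)"
    by (rule Abel_alternating)
  have "((\<lambda>t. mzv_series (Plain 1 # s) (- t)) \<longlongrightarrow> l) (at_left 1)"
    using l(2) unfolding c_def mzv_series_def[symmetric] mzv_series_Bar .
  then have "l = L" by (rule tendsto_unique[rotated, OF _ lim]) simp
  have "alt_mzv_trunc (Bar 1 # s) \<longlonglongrightarrow> l"
    using l(1) unfolding sums_def_le alt_mzv_trunc_eq_sum_coeff[OF pos, abs_def]
    by (simp add: c_def)
  with \<open>l = L\<close> show ?thesis by (simp add: alt_mzv_def limI)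
qed

text \<open>For weight at least 2 the coefficients are absolutely summable. The factor x pulled out
  below compensates for indexing the series from 0.\<close>

lemma tendsto_polylog_1:
  assumes "p \<ge> 2"
  shows "(polylog p \<longlongrightarrow> zeta_value p) (at_left 1)"
proof -
  have s: "summable (\<lambda>n. 1 / real (Suc n) ^ p)"
    using inverse_power_summable[of p] assms
    by (subst summable_Suc_iff[of "\<lambda>n. 1 / real n ^ p"]) (simp add: inverse_eq_divide)
  have "((\<lambda>x. x * (\<Sum>n. 1 / real (Suc n) ^ p * x ^ n)) \<longlongrightarrow> 1 * zeta_value p) (at_left 1)"
    unfolding zeta_value_def
    by (intro tendsto_intros tendsto_power_series_at_left_1) (use s in simp)
  moreover have "\<forall>\<^sub>F x :: real in at_left 1. x \<in> {0<..<1}"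
    by (intro eventually_at_left_real) auto
  then have "\<forall>\<^sub>F x in at_left 1. x * (\<Sum>n. 1 / real (Suc n) ^ p * x ^ n) = polylog p x"
  proof eventually_elim
    case (elim x)
    have "summable (\<lambda>n. 1 / real (Suc n) ^ p * x ^ n)"
    proof (rule summable_comparison_test[OF _ s], intro exI allI impI)
      fix n :: nat
      show "norm (1 / real (Suc n) ^ p * x ^ n) \<le> 1 / real (Suc n) ^ p"
        using elim by (auto simp: abs_mult intro!: divide_right_mono power_le_one)
    qed
    from suminf_mult[OF this, of x] show ?case
      by (simp add: polylog_def mult_ac)
  qed
  ultimately have "((\<lambda>x. polylog p x) \<longlongrightarrow> 1 * zeta_value p) (at_left 1)"
    by (rule Lim_transform_eventually)
  then show ?thesis by simp
qed

section \<open>Boundary values\<close>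

text \<open>For j < q the weight is at least 2 and the polylogarithm tends to a zeta value, which
  any positive power of the logarithm kills. For j = q the weight-1 polylogarithm diverges only
  logarithmically, and one of the j \<ge> 1 factors ln (1 + t) compensates for it.\<close>

lemma tendsto_ln_power_mult_polylog:
  assumes "q \<ge> 1" "j \<le> q"
  shows "((\<lambda>t. ln (1 + t) ^ j / fact j * polylog (Suc (q - j)) (1 / (1 + t)))
    \<longlongrightarrow> (if j = 0 then zeta_value (Suc q) else 0)) (at_right 0)"
proof (cases "j < q")
  case True
  have "filterlim (\<lambda>t::real. 1 / (1 + t)) (at_left 1) (at_right 0)" by real_asymp
  then have "((\<lambda>t. polylog (Suc (q - j)) (1 / (1 + t))) \<longlongrightarrow> zeta_value (Suc (q - j))) (at_right 0)"
    using True by (intro filterlim_compose[OF tendsto_polylog_1]) auto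
  then have "((\<lambda>t. ln (1 + t) ^ j / fact j * polylog (Suc (q - j)) (1 / (1 + t)))
    \<longlongrightarrow> ln (1 + 0) ^ j / fact j * zeta_value (Suc (q - j))) (at_right 0)"
    by (intro tendsto_intros) auto
  then show ?thesis by (auto simp: power_0_left split: if_splits)
next
  case False
  with assms obtain i where j: "j = Suc i" "q = Suc i" by (cases j) auto
  have "((\<lambda>t::real. ln (1 + t) * - ln (1 - 1 / (1 + t))) \<longlongrightarrow> 0) (at_right 0)" by real_asymp
  then have "((\<lambda>t::real. ln (1 + t) ^ i / fact j * (ln (1 + t) * - ln (1 - 1 / (1 + t))))
      \<longlongrightarrow> ln (1 + 0) ^ i / fact j * 0) (at_right 0)"
    by (intro tendsto_mult tendsto_intros) auto
  moreover have "\<forall>\<^sub>F t :: real in at_right 0. t \<in> {0<..<1}"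
    by (intro eventually_at_right_real) auto
  then have "\<forall>\<^sub>F t in at_right 0. ln (1 + t) ^ i / fact j * (ln (1 + t) * - ln (1 - 1 / (1 + t)))
      = ln (1 + t) ^ j / fact j * polylog (Suc (q - j)) (1 / (1 + t))"
  proof eventually_elim
    case (elim t)
    then have "polylog 1 (1 / (1 + t)) = - ln (1 - 1 / (1 + t))" by (intro polylog_1) auto
    then show ?case using j by simp
  qed
  ultimately have "((\<lambda>t. ln (1 + t) ^ j / fact j * polylog (Suc (q - j)) (1 / (1 + t)))
      \<longlongrightarrow> ln (1 + 0) ^ i / fact j * 0) (at_right 0)"
    by (rule Lim_transform_eventually)
  then show ?thesis using j by simp
qed

text \<open>The substitution u = 1/(1 + s), verified by differentiation: after telescoping, the
  derivative rests on 1/(1 + t) + 1/(t (1 + t)) = 1/t. The zeta value is the constant of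
  integration.\<close>

lemma ln_power_integral_eq:
  assumes "q \<ge> 1" "0 < t" "t < 1"
  shows "ln_power_integral q t = fact q * (zeta_value (Suc q) + ln (1 + t) ^ Suc q / fact (Suc q)
    - (\<Sum>j\<le>q. ln (1 + t) ^ j / fact j * polylog (Suc (q - j)) (1 / (1 + t))))"
proof -
  let ?H = "\<lambda>t. \<Sum>j\<le>q. ln (1 + t) ^ j / fact j * polylog (Suc (q - j)) (1 / (1 + t))"
  define R where "R t = fact q * (ln (1 + t) ^ Suc q / fact (Suc q) - ?H t)" for t
  have DERIV_R: "(R has_field_derivative ln (1 + t) ^ q / t) (at t)" if t: "0 < t" "t < 1" for t
  proof -
    have "((\<lambda>t. polylog (Suc i) (1 / (1 + t))) has_field_derivative
        - (polylog i (1 / (1 + t)) / (1 + t))) (at t)" for i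
      using t by (auto intro!: derivative_eq_intros simp: divide_simps power2_eq_square)
    then have "(?H has_field_derivative
        (\<Sum>j<q. ln (1 + t) ^ j / fact j * polylog (Suc (q - Suc j)) (1 / (1 + t))) / (1 + t)
        + (\<Sum>j\<le>q. ln (1 + t) ^ j / fact j * (- (polylog (q - j) (1 / (1 + t)) / (1 + t))))) (at t)"
      using t by (intro DERIV_ln_powers_convolution[where g = "\<lambda>i t. polylog (Suc i) (1 / (1 + t))"]) auto
    \<comment> \<open>For j < q the terms of both sums have weight q - j and cancel; only j = q
      remains, with the weight-0 polylogarithm.\<close>
    also have "(\<Sum>j<q. ln (1 + t) ^ j / fact j * polylog (Suc (q - Suc j)) (1 / (1 + t))) / (1 + t)
        + (\<Sum>j\<le>q. ln (1 + t) ^ j / fact j * (- (polylog (q - j) (1 / (1 + t)) / (1 + t))))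
        = - (ln (1 + t) ^ q / fact q * (polylog 0 (1 / (1 + t)) / (1 + t)))"
      by (simp add: sum_divide_distrib Suc_diff_Suc sum_negf flip: lessThan_Suc_atMost)
    also have "polylog 0 (1 / (1 + t)) = 1 / t"
      using t by (subst polylog_0) (auto simp: divide_simps)
    finally have "(?H has_field_derivative - (ln (1 + t) ^ q / fact q * (1 / t / (1 + t)))) (at t)" .
    moreover have "((\<lambda>t. ln (1 + t) ^ Suc q / fact (Suc q)) has_field_derivative
        ln (1 + t) ^ q / fact q * (1 / (1 + t))) (at t)"
      using t by (auto intro!: derivative_eq_intros simp del: power_Suc simp: divide_simps)
    ultimately have "(R has_field_derivative fact q * (ln (1 + t) ^ q / fact q * (1 / (1 + t))
        - - (ln (1 + t) ^ q / fact q * (1 / t / (1 + t))))) (at t)"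
      unfolding R_def by (intro DERIV_cmult DERIV_diff)
    also have "fact q * (ln (1 + t) ^ q / fact q * (1 / (1 + t))
        - - (ln (1 + t) ^ q / fact q * (1 / t / (1 + t)))) = ln (1 + t) ^ q * (1 / (1 + t) + 1 / t / (1 + t))"
    proof -
      have *: "c * (a / c * b - - (a / c * d)) = a * (b + d)" if "c \<noteq> 0" for a b c d :: real
        using that by (simp add: field_simps)
      show ?thesis by (rule *) simp
    qed
    also have "1 / (1 + t) + 1 / t / (1 + t) = 1 / t"
      using t by (simp add: divide_simps)
    finally show ?thesis by simp
  qed
  \<comment> \<open>At 0 the polylogarithms would have argument 1, outside the open unit interval,
    so the constant is found from the limit at 0 from the right.\<close>
  have const: "ln_power_integral q s - R s = ln_power_integral q t - R t" if "0 < s" "s < 1" for s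
  proof (rule DERIV_isconst3[where f = "\<lambda>s. ln_power_integral q s - R s" and a = 0 and b = 1])
    fix y :: real assume "y \<in> {0<..<1}"
    then show "((\<lambda>s. ln_power_integral q s - R s) has_field_derivative 0) (at y)"
      using DERIV_diff[OF DERIV_ln_power_integral[OF assms(1)] DERIV_R, of y] by simp
  qed (use assms that in auto)
  have "(R \<longlongrightarrow> fact q * (ln (1 + 0) ^ Suc q / fact (Suc q)
      - (\<Sum>j\<le>q. if j = 0 then zeta_value (Suc q) else 0))) (at_right 0)"
    unfolding R_def using assms(1)
    by (intro tendsto_intros tendsto_sum tendsto_ln_power_mult_polylog) auto
  then have "(R \<longlongrightarrow> - fact q * zeta_value (Suc q)) (at_right 0)"
    by (simp add: sum.delta)
  moreover have "(ln_power_integral q \<longlongrightarrow> 0) (at_right 0)"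
    using isCont_ln_power_integral[of 0 q] ln_power_integral_0[of q]
    by (auto simp: isCont_def intro: tendsto_mono[OF at_le])
  ultimately have "((\<lambda>s. ln_power_integral q s - R s) \<longlongrightarrow> 0 - - fact q * zeta_value (Suc q)) (at_right 0)"
    by (intro tendsto_diff)
  moreover have "\<forall>\<^sub>F s :: real in at_right 0. s \<in> {0<..<1}"
    by (intro eventually_at_right_real) auto
  then have "\<forall>\<^sub>F s in at_right 0. ln_power_integral q s - R s = ln_power_integral q t - R t"
    by eventually_elim (intro const, auto)
  ultimately have "((\<lambda>s. ln_power_integral q t - R t) \<longlongrightarrow> 0 - - fact q * zeta_value (Suc q)) (at_right (0::real))"
    by (rule Lim_transform_eventually)
  then have "ln_power_integral q t - R t = fact q * zeta_value (Suc q)"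
    by (simp add: tendsto_const_iff)
  then show ?thesis by (simp add: R_def algebra_simps)
qed

text \<open>The common value at t = 1 of the polylogarithm sums in
  \<open>mzv_series_ones_Bar\<close> and \<open>ln_power_integral_eq\<close>.\<close>

definition polylog_half_sum :: "nat \<Rightarrow> real" where
  "polylog_half_sum q = (\<Sum>j\<le>q. ln 2 ^ j / fact j * polylog (Suc (q - j)) (1 / 2))"

lemma tendsto_ln_power_integral:
  assumes "q \<ge> 1"
  shows "(ln_power_integral q \<longlongrightarrow> fact q * (zeta_value (Suc q) + ln 2 ^ Suc q / fact (Suc q)
    - polylog_half_sum q)) (at_left 1)"
proof -
  have "isCont (polylog (Suc i)) (1 / 2)" for i
    by (rule DERIV_isCont[OF DERIV_polylog]) auto
  then have "((\<lambda>t. polylog (Suc i) (1 / (1 + t))) \<longlongrightarrow> polylog (Suc i) (1 / 2)) (at_left 1)" for i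
    by (rule isCont_tendsto_compose) (auto intro!: tendsto_eq_intros)
  then have "((\<lambda>t. fact q * (zeta_value (Suc q) + ln (1 + t) ^ Suc q / fact (Suc q)
      - (\<Sum>j\<le>q. ln (1 + t) ^ j / fact j * polylog (Suc (q - j)) (1 / (1 + t))))) \<longlongrightarrow>
      fact q * (zeta_value (Suc q) + ln (1 + 1) ^ Suc q / fact (Suc q)
      - (\<Sum>j\<le>q. ln (1 + 1) ^ j / fact j * polylog (Suc (q - j)) (1 / 2)))) (at_left 1)"
    by (intro tendsto_intros tendsto_sum) auto
  then have lim: "((\<lambda>t. fact q * (zeta_value (Suc q) + ln (1 + t) ^ Suc q / fact (Suc q)
      - (\<Sum>j\<le>q. ln (1 + t) ^ j / fact j * polylog (Suc (q - j)) (1 / (1 + t))))) \<longlongrightarrow>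
      fact q * (zeta_value (Suc q) + ln 2 ^ Suc q / fact (Suc q) - polylog_half_sum q)) (at_left 1)"
    by (simp only: one_add_one polylog_half_sum_def)
  have "\<forall>\<^sub>F t :: real in at_left 1. t \<in> {0<..<1}"
    by (intro eventually_at_left_real) auto
  then have "\<forall>\<^sub>F t in at_left 1. fact q * (zeta_value (Suc q) + ln (1 + t) ^ Suc q / fact (Suc q)
      - (\<Sum>j\<le>q. ln (1 + t) ^ j / fact j * polylog (Suc (q - j)) (1 / (1 + t)))) = ln_power_integral q t"
    by eventually_elim (use assms ln_power_integral_eq in auto)
  with lim show ?thesis by (rule Lim_transform_eventually)
qed

text \<open>The leading bar becomes the sign of the argument, so \<open>mzv_series_ones_Bar\<close>
  is used with \<open>Suc m\<close> ones. As t tends to 1, (1 + t)/2 tends to 1 and produces the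
  zeta value.\<close>

lemma alt_mzv_Bar_ones_Bar:
  "alt_mzv (Bar 1 # replicate m (Plain 1) @ [Bar 1]) =
    (-1) ^ Suc m * (zeta_value (Suc (Suc m)) - polylog_half_sum (Suc m))"
proof (rule alt_mzv_Bar_1)
  have "filterlim (\<lambda>t::real. (1 + t) / 2) (at_left 1) (at_left 1)" by real_asymp
  then have "((\<lambda>t. polylog (Suc (Suc m)) ((1 + t) / 2)) \<longlongrightarrow> zeta_value (Suc (Suc m))) (at_left 1)"
    by (intro filterlim_compose[OF tendsto_polylog_1]) auto
  then have "((\<lambda>t. (-1) ^ Suc m * (polylog (Suc (Suc m)) ((1 + t) / 2)
      - (\<Sum>j\<le>Suc m. ln (1 + t) ^ j / fact j * polylog (Suc (Suc m - j)) (1 / 2)))) \<longlongrightarrow>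
      (-1) ^ Suc m * (zeta_value (Suc (Suc m))
      - (\<Sum>j\<le>Suc m. ln (1 + 1) ^ j / fact j * polylog (Suc (Suc m - j)) (1 / 2)))) (at_left 1)"
    by (intro tendsto_intros tendsto_sum) auto
  then have lim: "((\<lambda>t. (-1) ^ Suc m * (polylog (Suc (Suc m)) ((1 + t) / 2)
      - (\<Sum>j\<le>Suc m. ln (1 + t) ^ j / fact j * polylog (Suc (Suc m - j)) (1 / 2)))) \<longlongrightarrow>
      (-1) ^ Suc m * (zeta_value (Suc (Suc m)) - polylog_half_sum (Suc m))) (at_left 1)"
    by (simp only: one_add_one polylog_half_sum_def)
  have "\<forall>\<^sub>F t :: real in at_left 1. t \<in> {0<..<1}"
    by (intro eventually_at_left_real) auto
  then have "\<forall>\<^sub>F t in at_left 1. (-1) ^ Suc m * (polylog (Suc (Suc m)) ((1 + t) / 2)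
      - (\<Sum>j\<le>Suc m. ln (1 + t) ^ j / fact j * polylog (Suc (Suc m - j)) (1 / 2)))
      = mzv_series (Plain 1 # replicate m (Plain 1) @ [Bar 1]) (- t)"
  proof eventually_elim
    case (elim t)
    then show ?case using mzv_series_ones_Bar[of t "Suc m"] by simp
  qed
  with lim show "((\<lambda>t. mzv_series (Plain 1 # replicate m (Plain 1) @ [Bar 1]) (- t)) \<longlongrightarrow>
      (-1) ^ Suc m * (zeta_value (Suc (Suc m)) - polylog_half_sum (Suc m))) (at_left 1)"
    by (rule Lim_transform_eventually)
qed auto

text \<open>Again the unbarred leading 1 raises the number of ones to \<open>Suc m\<close>; the
  limits of the integrals are inserted term by term, their indices being at least k.\<close>

lemma alt_mzv_Bar_ones_2_ones:
  assumes "k \<ge> 1"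
  shows "alt_mzv (Bar 1 # replicate m (Plain 1) @ Plain 2 # replicate (k - 1) (Plain 1)) =
    (-1) ^ (Suc m + k) * (\<Sum>j\<le>Suc m. ln 2 ^ j / fact j *
      ((-1) ^ (Suc m - j) / (fact k * fact (Suc m - j)) * (fact (k + (Suc m - j)) *
        (zeta_value (Suc (k + (Suc m - j))) + ln 2 ^ Suc (k + (Suc m - j)) / fact (Suc (k + (Suc m - j)))
          - polylog_half_sum (k + (Suc m - j))))))"
    (is "_ = ?L")
proof (rule alt_mzv_Bar_1)
  let ?s = "replicate m (Plain 1) @ Plain 2 # replicate (k - 1) (Plain 1)"
  let ?f = "\<lambda>t. (-1) ^ (Suc m + k) * (\<Sum>j\<le>Suc m. ln (1 + t) ^ j / fact j *
      ((-1) ^ (Suc m - j) / (fact k * fact (Suc m - j)) * ln_power_integral (k + (Suc m - j)) t))"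
  have "((\<lambda>t::real. ln (1 + t)) \<longlongrightarrow> ln 2) (at_left 1)"
    by (auto intro!: tendsto_eq_intros)
  then have lim: "(?f \<longlongrightarrow> ?L) (at_left 1)"
    using assms by (intro tendsto_mult tendsto_divide tendsto_power tendsto_const tendsto_sum
      tendsto_ln_power_integral) auto
  have "\<forall>\<^sub>F t :: real in at_left 1. t \<in> {0<..<1}"
    by (intro eventually_at_left_real) auto
  then have "\<forall>\<^sub>F t in at_left 1. ?f t = mzv_series (Plain 1 # ?s) (- t)"
  proof eventually_elim
    case (elim t)
    then show ?case using mzv_series_ones_2_ones[OF assms, of t "Suc m"] by simp
  qed
  with lim show "((\<lambda>t. mzv_series (Plain 1 # ?s) (- t)) \<longlongrightarrow> ?L) (at_left 1)"
    by (rule Lim_transform_eventually)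
qed auto

section \<open>The span of the constants\<close>

abbreviation "basic_span \<equiv> real_over_rat.span (products_of basic_constants)"

lemma basic_constant_in_span: "x \<in> basic_constants \<Longrightarrow> x \<in> basic_span"
  by (rule real_over_rat.span_base) (auto simp: products_of_def intro!: exI[of _ "[x]"])

lemma ln_2_in_span: "ln 2 \<in> basic_span"
  and zeta_in_span: "n \<ge> 2 \<Longrightarrow> zeta_value n \<in> basic_span"
  and polylog_half_in_span: "n \<ge> 1 \<Longrightarrow> polylog n (1 / 2) \<in> basic_span"
  by (rule basic_constant_in_span, force simp: basic_constants_def)+

text \<open>Concatenating factor lists multiplies two products; two nested span inductions extend
  this bilinearly.\<close>

lemma mult_in_span:
  assumes "x \<in> basic_span" "y \<in> basic_span"
  shows "x * y \<in> basic_span"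
  using assms(1)
proof (induction rule: real_over_rat.span_induct_alt)
  case base
  show ?case by (simp add: real_over_rat.span_zero)
next
  case (step c a z)
  have "a * y \<in> basic_span"
    using assms(2)
  proof (induction rule: real_over_rat.span_induct_alt)
    case base
    show ?case by (simp add: real_over_rat.span_zero)
  next
    case (step d b w)
    obtain xs ys where "a = prod_list xs" "b = prod_list ys" "xs \<noteq> []"
      "set xs \<subseteq> basic_constants" "set ys \<subseteq> basic_constants"
      using \<open>a \<in> products_of basic_constants\<close> step(1) by (auto simp: products_of_def)
    then have "a * b \<in> products_of basic_constants"
      unfolding products_of_def by (intro CollectI exI[of _ "xs @ ys"]) auto
    then have "of_rat d * (a * b) + a * w \<in> basic_span"
      by (intro real_over_rat.span_add real_over_rat.span_scale real_over_rat.span_base step)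
    then show ?case by (simp add: algebra_simps)
  qed
  then have "of_rat c * (a * y) + z * y \<in> basic_span"
    by (intro real_over_rat.span_add real_over_rat.span_scale step)
  then show ?case by (simp add: algebra_simps)
qed

lemma rat_mult_in_span:
  assumes "q \<in> \<rat>" "x \<in> basic_span"
  shows "q * x \<in> basic_span"
  using assms real_over_rat.span_scale[of x] by (auto elim!: Rats_cases)

lemma power_mult_in_span:
  "x \<in> basic_span \<Longrightarrow> y \<in> basic_span \<Longrightarrow> x ^ j * y \<in> basic_span"
  by (induction j) (auto simp: mult.assoc intro: mult_in_span)

lemma fact_in_Rats [simp]: "fact n \<in> (\<rat> :: real set)"
  by (metis Rats_of_nat of_nat_fact)

lemma ln_2_power_div_fact_mult_in_span:
  assumes "y \<in> basic_span"
  shows "ln 2 ^ j / fact j * y \<in> basic_span"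
proof -
  have "1 / fact j * (ln 2 ^ j * y) \<in> basic_span"
    by (intro rat_mult_in_span power_mult_in_span ln_2_in_span assms Rats_divide) auto
  then show ?thesis by simp
qed

lemma polylog_half_sum_in_span: "polylog_half_sum q \<in> basic_span"
  unfolding polylog_half_sum_def
  by (intro real_over_rat.span_sum ln_2_power_div_fact_mult_in_span polylog_half_in_span) auto

theorem theorem6p1:
  fixes m k :: nat
  assumes "m \<ge> 1" and "k \<ge> 1"
  shows "alt_mzv ([Bar 1] @ replicate (m - 1) (Plain 1) @ [Bar 1])
           \<in> real_over_rat.span (products_of basic_constants)
       \<and> alt_mzv ([Bar 1] @ replicate (m - 1) (Plain 1) @ [Plain 2] @ replicate (k - 1) (Plain 1))
           \<in> real_over_rat.span (products_of basic_constants)"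
proof
  have "(-1) ^ Suc n * (zeta_value (Suc (Suc n)) - polylog_half_sum (Suc n)) \<in> basic_span" for n
    by (intro rat_mult_in_span real_over_rat.span_diff zeta_in_span polylog_half_sum_in_span) auto
  then show "alt_mzv ([Bar 1] @ replicate (m - 1) (Plain 1) @ [Bar 1]) \<in> basic_span"
    using alt_mzv_Bar_ones_Bar[of "m - 1"] by simp
  have *: "zeta_value (Suc q) + ln 2 ^ Suc q / fact (Suc q) - polylog_half_sum q \<in> basic_span"
    if "q \<ge> 1" for q
  proof -
    \<comment> \<open>One factor ln 2 is split off to serve as the trailing element of the
      span.\<close>
    have "1 / fact (Suc q) * (ln 2 ^ q * ln 2) \<in> basic_span"
      by (intro rat_mult_in_span power_mult_in_span ln_2_in_span Rats_divide) auto
    then have "ln 2 ^ Suc q / fact (Suc q) \<in> basic_span" by (simp add: mult.commute)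
    then show ?thesis using that
      by (intro real_over_rat.span_add real_over_rat.span_diff zeta_in_span polylog_half_sum_in_span) auto
  qed
  \<comment> \<open>All coefficients are signed ratios of factorials, hence rational; every index
    passed to \<open>*\<close> is at least k \<ge> 1.\<close>
  have "alt_mzv (Bar 1 # replicate (m - 1) (Plain 1) @ Plain 2 # replicate (k - 1) (Plain 1)) \<in> basic_span"
    unfolding alt_mzv_Bar_ones_2_ones[OF assms(2)]
    by (intro rat_mult_in_span real_over_rat.span_sum ln_2_power_div_fact_mult_in_span * Rats_divide Rats_mult Rats_power)
      (use assms(2) in auto)
  then show "alt_mzv ([Bar 1] @ replicate (m - 1) (Plain 1) @ [Plain 2] @ replicate (k - 1) (Plain 1))
      \<in> basic_span"
    by simp
qed

end
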